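(* The set of GIG semigroup generators on $\mathscr A_{\mathcal H_1}$ is a convex cone. That is, if $\mathcal L_1$ and $\mathcal L_2$ are GIG semigroup generators, then for all $a,b\ge0$, $a\mathcal L_1+b\mathcal L_2$ is a GIG semigroup generator.
   Context: Let $\mathcal H_1$ be a complex Hilbert space of finite dimension $N$ (inner product conjugate linear in the first variable). A CAR field over $\mathcal H_1$ is a conjugate linear map $\psi\mapsto Z(\psi)$ into bounded operators on a Hilbert space $\mathscr K$ with, writing $Z^*(\psi)=Z(\psi)^*$, $Z(\psi)Z^*(\phi)+Z^*(\phi)Z(\psi)=\langle\psi,\phi\rangle1$ and $Z(\psi)Z(\phi)+Z(\phi)Z(\psi)=0$. Fix one acting irreducibly; then $\dim\mathscr K=2^N$ and the generated $*$-algebra is $\mathscr A_{\mathcal H_1}=\mathcal B(\mathscr K)$. Let $\tau=2^{-N}\mathrm{Tr}$; density matrices are operators $\rho\ge0$ with $\tau(\rho)=1$. The number operator is $\mathcal N=\sum_jZ^*(\psi_j)Z(\psi_j)$ (any orthonormal basis). For $Q=\sum_j\mu_j|\psi_j\rangle\langle\psi_j|$ (spectral decomposition) with $0\le Q\le1$ on $\mathcal H_1$, $\rho_Q=\prod_{j=1}^N\big((1-\mu_j)2Z(\psi_j)Z^*(\psi_j)+\mu_j2Z^*(\psi_j)Z(\psi_j)\big)$ is the density matrix of the gauge invariant Gaussian (GIG) state with symbol $Q$; $\mathfrak S_{GIG}$ is the set of all $\rho_Q$, $0\le Q\le 1$. A quantum operation is a completely positive trace preserving linear map. A GIG quantum operation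 on $\mathscr A_{\mathcal H_1}$ is a quantum operation $\Phi$ that maps $\mathfrak S_{GIG}$ into itself and is gauge covariant: $\Phi(e^{-it\mathcal N}Xe^{it\mathcal N})=e^{-it\mathcal N}\Phi(X)e^{it\mathcal N}$ for all $t\in\mathbb R$ and all $X$. A GIG semigroup is a family $\{\mathcal P_t\}_{t\ge0}$ of GIG quantum operations with $\mathcal P_0=1$, $\mathcal P_s\mathcal P_t=\mathcal P_{s+t}$, and $t\mapsto\mathcal P_t$ continuous; $\mathcal L$ is a GIG semigroup generator if $\{e^{t\mathcal L}\}_{t\ge0}$ is a GIG semigroup. *)

theory Defs
  imports "HOL-Analysis.Analysis"
begin

text \<open>
  The one-particle space is \<open>complex^'n\<close>, so that \<open>N = CARD('n)\<close>, and the CAR field acts on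
  \<open>complex^'k\<close>, whose operators are the matrices \<open>complex^'k^'k\<close>. That \<open>CARD('k) = 2 ^ CARD('n)\<close>
  is not assumed: it is a consequence of irreducibility.
\<close>

definition cip :: "complex^'m \<Rightarrow> complex^'m \<Rightarrow> complex" where
  "cip x y = (\<Sum>i\<in>UNIV. cnj (x $ i) * y $ i)"

definition adj :: "complex^'m^'m \<Rightarrow> complex^'m^'m" where
  "adj A = map_matrix cnj (transpose A)"

definition cscale :: "complex \<Rightarrow> complex^'m^'m \<Rightarrow> complex^'m^'m" where
  "cscale c = map_matrix ((*) c)"

definition ketbra :: "complex^'m \<Rightarrow> complex^'m^'m" where
  "ketbra x = (\<chi> i j. x $ i * cnj (x $ j))"

definition psd :: "complex^'m^'m \<Rightarrow> bool" where
  "psd A \<longleftrightarrow> (\<forall>v. cip v (A *v v) \<in> \<real>\<^sub>\<ge>\<^sub>0)"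

text \<open>
  The componentwise product makes \<open>complex^'m^'m\<close> no normed algebra for the matrix product, so
  the class-based \<open>exp\<close> is not available for it.
\<close>
definition mat_exp :: "complex^'m^'m \<Rightarrow> complex^'m^'m" where
  "mat_exp A = (\<Sum>n. (1 / fact n) *\<^sub>R (((**) A ^^ n) (mat 1)))"


definition CAR_field :: "(complex^'n \<Rightarrow> complex^'k^'k) \<Rightarrow> bool" where
  "CAR_field Z \<longleftrightarrow>
     (\<forall>\<psi> \<phi>. Z (\<psi> + \<phi>) = Z \<psi> + Z \<phi>) \<and>
     (\<forall>c \<psi>. Z (c *s \<psi>) = cscale (cnj c) (Z \<psi>)) \<and>
     (\<forall>\<psi> \<phi>. Z \<psi> ** adj (Z \<phi>) + adj (Z \<phi>) ** Z \<psi> = cscale (cip \<psi> \<phi>) (mat 1)) \<and>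
     (\<forall>\<psi> \<phi>. Z \<psi> ** Z \<phi> + Z \<phi> ** Z \<psi> = 0)"

definition irreducible_field :: "(complex^'n \<Rightarrow> complex^'k^'k) \<Rightarrow> bool" where
  "irreducible_field Z \<longleftrightarrow>
     (\<forall>S. vec.subspace S \<and> (\<forall>\<psi>. \<forall>v\<in>S. Z \<psi> *v v \<in> S \<and> adj (Z \<psi>) *v v \<in> S)
        \<longrightarrow> S = {0} \<or> S = UNIV)"

text \<open>
  Orthonormal bases are enumerated by the naturals below \<open>CARD('n)\<close>; the other values of the
  sequence are irrelevant.
\<close>
definition is_onb :: "(nat \<Rightarrow> complex^'n) \<Rightarrow> bool" where
  "is_onb \<psi> \<longleftrightarrow>
     (\<forall>i<CARD('n). \<forall>j<CARD('n). cip (\<psi> i) (\<psi> j) = (if i = j then 1 else 0))"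

text \<open>Here the sum runs over the standard basis; it does not depend on the orthonormal basis.\<close>
definition number_op :: "(complex^'n \<Rightarrow> complex^'k^'k) \<Rightarrow> complex^'k^'k" where
  "number_op Z = (\<Sum>j\<in>UNIV. adj (Z (axis j 1)) ** Z (axis j 1))"

definition spectral_decomp :: "complex^'n^'n \<Rightarrow> (nat \<Rightarrow> real) \<Rightarrow> (nat \<Rightarrow> complex^'n) \<Rightarrow> bool" where
  "spectral_decomp Q \<mu> \<psi> \<longleftrightarrow> is_onb \<psi> \<and> Q = (\<Sum>j<CARD('n). \<mu> j *\<^sub>R ketbra (\<psi> j))"

definition gauss_prod ::
    "(complex^'n \<Rightarrow> complex^'k^'k) \<Rightarrow> (nat \<Rightarrow> real) \<Rightarrow> (nat \<Rightarrow> complex^'n) \<Rightarrow> complex^'k^'k" where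
  "gauss_prod Z \<mu> \<psi> =
     foldr (**)
       (map (\<lambda>j. (2 * (1 - \<mu> j)) *\<^sub>R (Z (\<psi> j) ** adj (Z (\<psi> j)))
               + (2 * \<mu> j) *\<^sub>R (adj (Z (\<psi> j)) ** Z (\<psi> j))) [0..<CARD('n)])
       (mat 1)"

text \<open>
  The density matrix with symbol \<open>Q\<close> is a relation here, since the spectral decomposition of
  \<open>Q\<close> is not unique; all decompositions of \<open>Q\<close> yield the same matrix.
\<close>
definition gig_density ::
    "(complex^'n \<Rightarrow> complex^'k^'k) \<Rightarrow> complex^'n^'n \<Rightarrow> complex^'k^'k \<Rightarrow> bool" where
  "gig_density Z Q \<rho> \<longleftrightarrow> (\<exists>\<mu> \<psi>. spectral_decomp Q \<mu> \<psi> \<and> \<rho> = gauss_prod Z \<mu> \<psi>)"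

definition gig_states :: "(complex^'n \<Rightarrow> complex^'k^'k) \<Rightarrow> (complex^'k^'k) set" where
  "gig_states Z = {\<rho>. \<exists>Q. psd Q \<and> psd (mat 1 - Q) \<and> gig_density Z Q \<rho>}"


text \<open>
  The type \<open>'k superop\<close> consists of the real linear maps, hence complex linearity is a
  separate predicate.
\<close>
type_synonym 'k superop = "(complex^'k^'k) \<Rightarrow>\<^sub>L (complex^'k^'k)"

definition complex_linear :: "'k::finite superop \<Rightarrow> bool" where
  "complex_linear \<Phi> \<longleftrightarrow> (\<forall>c X. \<Phi> (cscale c X) = cscale c (\<Phi> X))"

text \<open>Positivity of the \<open>n \<times> n\<close> block matrix \<open>(X i j)\<close> acting on \<open>n\<close> copies of \<open>complex^'k\<close>.\<close>
definition block_psd :: "nat \<Rightarrow> (nat \<Rightarrow> nat \<Rightarrow> complex^'k^'k) \<Rightarrow> bool" where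
  "block_psd n X \<longleftrightarrow>
     (\<forall>v :: nat \<Rightarrow> complex^'k. (\<Sum>i<n. \<Sum>j<n. cip (v i) (X i j *v v j)) \<in> \<real>\<^sub>\<ge>\<^sub>0)"

definition completely_positive :: "'k::finite superop \<Rightarrow> bool" where
  "completely_positive \<Phi> \<longleftrightarrow> (\<forall>n X. block_psd n X \<longrightarrow> block_psd n (\<lambda>i j. \<Phi> (X i j)))"

definition trace_preserving :: "'k::finite superop \<Rightarrow> bool" where
  "trace_preserving \<Phi> \<longleftrightarrow> (\<forall>X. trace (\<Phi> X) = trace X)"

definition quantum_operation :: "'k::finite superop \<Rightarrow> bool" where
  "quantum_operation \<Phi> \<longleftrightarrow> complex_linear \<Phi> \<and> completely_positive \<Phi> \<and> trace_preserving \<Phi>"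

definition gauge_covariant :: "(complex^'n \<Rightarrow> complex^'k^'k) \<Rightarrow> 'k superop \<Rightarrow> bool" where
  "gauge_covariant Z \<Phi> \<longleftrightarrow>
     (\<forall>(t::real) X.
        \<Phi> (mat_exp (cscale (- \<i> * t) (number_op Z)) ** X ** mat_exp (cscale (\<i> * t) (number_op Z)))
        = mat_exp (cscale (- \<i> * t) (number_op Z)) ** \<Phi> X ** mat_exp (cscale (\<i> * t) (number_op Z)))"

definition gig_operation :: "(complex^'n \<Rightarrow> complex^'k^'k) \<Rightarrow> 'k superop \<Rightarrow> bool" where
  "gig_operation Z \<Phi> \<longleftrightarrow>
     quantum_operation \<Phi> \<and> (\<forall>\<rho>\<in>gig_states Z. \<Phi> \<rho> \<in> gig_states Z) \<and> gauge_covariant Z \<Phi>"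

definition gig_semigroup :: "(complex^'n \<Rightarrow> complex^'k^'k) \<Rightarrow> (real \<Rightarrow> 'k superop) \<Rightarrow> bool" where
  "gig_semigroup Z P \<longleftrightarrow>
     (\<forall>t\<ge>0. gig_operation Z (P t)) \<and>
     P 0 = id_blinfun \<and>
     (\<forall>s\<ge>0. \<forall>t\<ge>0. P s o\<^sub>L P t = P (s + t)) \<and>
     continuous_on {0..} P"

definition superop_exp :: "'k::finite superop \<Rightarrow> 'k superop" where
  "superop_exp L = (\<Sum>n. (1 / fact n) *\<^sub>R (((o\<^sub>L) L ^^ n) id_blinfun))"

definition gig_generators :: "(complex^'n \<Rightarrow> complex^'k^'k) \<Rightarrow> 'k superop set" where
  "gig_generators Z = {L. complex_linear L \<and> gig_semigroup Z (\<lambda>t. superop_exp (t *\<^sub>R L))}"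

end

theory Submission
  imports Defs
begin

text \<open>
  GIG operations are closed under composition and, since the set of GIG states is compact, under
  limits. By the Trotter product formula
  \<open>exp (t (L\<^sub>1 + L\<^sub>2)) = lim (exp (t L\<^sub>1 / n) exp (t L\<^sub>2 / n))\<^sup>n\<close>, the sum of two generators
  is therefore again a generator. Compactness of the set of GIG states holds because it is the
  image, under a continuous map, of the compact set of pairs of eigenvalue sequences in \<open>[0, 1]\<close>
  and orthonormal bases.
\<close>

section \<open>The Trotter product formula in a Banach algebra\<close>

text \<open>Telescoping turns a one-step error into an \<open>m\<close>-step error. The exponent
  \<open>m\<close> in place of \<open>m - 1\<close> costs only a factor \<open>M\<close>, harmless
  since \<open>1 \<le> M\<close>, and avoids natural subtraction.\<close>

lemma norm_power_diff_le:
  fixes z w :: "'a::real_normed_algebra_1"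
  assumes "norm z \<le> M" "norm w \<le> M" "1 \<le> M"
  shows "norm (z ^ m - w ^ m) \<le> m * M ^ m * norm (z - w)"
proof (induction m)
  case 0
  then show ?case by simp
next
  case (Suc m)
  have "z ^ Suc m - w ^ Suc m = z * (z ^ m - w ^ m) + (z - w) * w ^ m"
    by (simp add: algebra_simps)
  also have "norm \<dots> \<le> norm z * norm (z ^ m - w ^ m) + norm (z - w) * norm (w ^ m)"
    by (intro norm_triangle_le add_mono norm_mult_ineq)
  also have "\<dots> \<le> M * (m * M ^ m * norm (z - w)) + norm (z - w) * M ^ Suc m"
  proof (intro add_mono mult_mono Suc.IH assms)
    have "norm (w ^ m) \<le> norm w ^ m" by (rule norm_power_ineq)
    also have "\<dots> \<le> M ^ m" using assms by (intro power_mono) auto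
    also have "\<dots> \<le> M ^ Suc m" using assms by (intro power_increasing) auto
    finally show "norm (w ^ m) \<le> M ^ Suc m" .
  qed (use assms in auto)
  also have "\<dots> = Suc m * M ^ Suc m * norm (z - w)"
    by (simp add: algebra_simps)
  finally show ?case .
qed

lemma exp_scaleR_power:
  fixes A :: "'a::{real_normed_algebra_1, banach}"
  shows "exp A ^ n = exp (real n *\<^sub>R A)"
proof (induction n)
  case (Suc n)
  have "exp (real (Suc n) *\<^sub>R A) = exp (A + real n *\<^sub>R A)"
    by (simp add: algebra_simps)
  also have "\<dots> = exp A * exp (real n *\<^sub>R A)"
    by (rule exp_add_commuting) simp
  finally show ?case using Suc by simp
qed simp

text \<open>One factor of the product agrees with \<open>exp ((A + B) / n)\<close> up to an error of
  order o(1/n). Over \<open>n\<close> steps the error grows at most by a factor of order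
  \<open>n\<close>, so it still vanishes in the limit.\<close>

theorem Trotter_product_formula:
  fixes A B :: "'a::{real_normed_algebra_1, banach}"
  shows "(\<lambda>n. (exp ((1 / real n) *\<^sub>R A) * exp ((1 / real n) *\<^sub>R B)) ^ n) \<longlonglongrightarrow> exp (A + B)"
proof -
  define H where "H h = exp (h *\<^sub>R A) * exp (h *\<^sub>R B) - exp (h *\<^sub>R (A + B))" for h :: real
  define c where "c = norm A + norm B"
  \<comment> \<open>The derivative is written as the product rule delivers it. At 0 all exponentials
    are 1 and it collapses to \<open>B + A - (A + B) = 0\<close>.\<close>
  have "(H has_vector_derivative
      (exp (0 *\<^sub>R A) * (exp (0 *\<^sub>R B) * B) + exp (0 *\<^sub>R A) * A * exp (0 *\<^sub>R B))
      - exp (0 *\<^sub>R (A + B)) * (A + B)) (at 0)"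
    unfolding H_def
    by (intro has_vector_derivative_diff has_vector_derivative_mult
        exp_scaleR_has_vector_derivative_right)
  then have "(H has_vector_derivative 0) (at 0)"
    by (simp add: algebra_simps)
  moreover have "H 0 = 0"
    by (simp add: H_def)
  ultimately have "((\<lambda>h. norm (H h) / norm h) \<longlongrightarrow> 0) (at 0)"
    by (simp add: has_vector_derivative_def has_derivative_at divide_inverse mult.commute)
  \<comment> \<open>The punctured filter \<open>at 0\<close> requires \<open>1 / real n\<close> to
    be nonzero, which holds from \<open>n = 1\<close> on.\<close>
  moreover have "filterlim (\<lambda>n. 1 / real n) (at 0) sequentially"
    by (auto simp: filterlim_at lim_1_over_n eventually_sequentially intro: exI[of _ 1])
  ultimately have "(\<lambda>n. norm (H (1 / real n)) / norm (1 / real n)) \<longlonglongrightarrow> 0"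
    by (rule filterlim_compose)
  then have lim: "(\<lambda>n. exp c * (norm (H (1 / real n)) / norm (1 / real n))) \<longlonglongrightarrow> 0"
    by (rule tendsto_mult_right_zero)
  have "(\<lambda>n. (exp ((1 / real n) *\<^sub>R A) * exp ((1 / real n) *\<^sub>R B)) ^ n - exp (A + B)) \<longlonglongrightarrow> 0"
  proof (rule Lim_null_comparison[OF _ lim], rule eventually_sequentiallyI[of 1])
    fix n :: nat
    assume n: "1 \<le> n"
    define z where "z = exp ((1 / real n) *\<^sub>R A) * exp ((1 / real n) *\<^sub>R B)"
    define w where "w = exp ((1 / real n) *\<^sub>R (A + B))"
    have "norm z \<le> norm (exp ((1 / real n) *\<^sub>R A)) * norm (exp ((1 / real n) *\<^sub>R B))"
      unfolding z_def by (rule norm_mult_ineq)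
    also have "\<dots> \<le> exp (norm ((1 / real n) *\<^sub>R A)) * exp (norm ((1 / real n) *\<^sub>R B))"
      by (intro mult_mono norm_exp) auto
    also have "\<dots> = exp (c / n)"
      by (simp add: c_def exp_add[symmetric] add_divide_distrib)
    finally have z: "norm z \<le> exp (c / n)" .
    have "norm w \<le> exp (norm ((1 / real n) *\<^sub>R (A + B)))"
      unfolding w_def by (rule norm_exp)
    also have "\<dots> \<le> exp (c / n)"
      by (simp add: c_def norm_triangle_ineq divide_right_mono)
    finally have w: "norm w \<le> exp (c / n)" .
    have "norm (z ^ n - w ^ n) \<le> n * exp (c / n) ^ n * norm (z - w)"
      by (rule norm_power_diff_le[OF z w]) (simp add: c_def)
    \<comment> \<open>The common bound \<open>exp (c / n)\<close> is chosen so that its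
      \<open>n\<close>-th power does not depend on \<open>n\<close>. The remaining factor
      \<open>n\<close> is the denominator of the difference quotient of \<open>H\<close> at
      \<open>1 / n\<close>.\<close>
    also have "exp (c / n) ^ n = exp c"
      using n by (simp add: exp_of_nat_mult[symmetric])
    finally show "norm (z ^ n - exp (A + B)) \<le> exp c * (norm (H (1 / real n)) / norm (1 / real n))"
      using n by (simp add: exp_scaleR_power w_def H_def z_def mult_ac)
  qed
  then show ?thesis
    by (rule LIM_zero_cancel)
qed

section \<open>The Banach algebra of bounded endomorphisms\<close>

text \<open>
  The bounded endomorphisms as a type of their own, so that they are an instance of the class of
  Banach algebras and the library's \<open>exp\<close> applies to them.
\<close>
typedef (overloaded) 'a endo = "UNIV :: ('a::real_normed_vector \<Rightarrow>\<^sub>L 'a) set"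
  morphisms blinfun_of_endo Endo ..

setup_lifting type_definition_endo

instantiation endo :: (real_normed_vector) real_normed_vector
begin

lift_definition norm_endo :: "'a endo \<Rightarrow> real" is norm .
lift_definition minus_endo :: "'a endo \<Rightarrow> 'a endo \<Rightarrow> 'a endo" is "(-)" .
lift_definition plus_endo :: "'a endo \<Rightarrow> 'a endo \<Rightarrow> 'a endo" is "(+)" .
lift_definition uminus_endo :: "'a endo \<Rightarrow> 'a endo" is uminus .
lift_definition zero_endo :: "'a endo" is 0 .
lift_definition scaleR_endo :: "real \<Rightarrow> 'a endo \<Rightarrow> 'a endo" is "(*\<^sub>R)" .

definition dist_endo :: "'a endo \<Rightarrow> 'a endo \<Rightarrow> real"
  where "dist_endo a b = norm (a - b)"

definition [code del]:
  "(uniformity :: ('a endo \<times> 'a endo) filter) = (INF e\<in>{0 <..}. principal {(x, y). dist x y < e})"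

definition open_endo :: "'a endo set \<Rightarrow> bool"
  where [code del]: "open_endo S = (\<forall>x\<in>S. \<forall>\<^sub>F (x', y) in uniformity. x' = x \<longrightarrow> y \<in> S)"

definition sgn_endo :: "'a endo \<Rightarrow> 'a endo"
  where "sgn_endo x = scaleR (inverse (norm x)) x"

instance
  apply standard
  unfolding dist_endo_def open_endo_def sgn_endo_def uniformity_endo_def
  by (rule refl | (transfer, simp add: algebra_simps norm_triangle_ineq))+

end

text \<open>The sort \<open>perfect_space\<close> excludes the zero space, so that the identity has
  norm 1 and differs from 0.\<close>

instantiation endo :: ("{real_normed_vector, perfect_space}") real_normed_algebra_1
begin

lift_definition times_endo :: "'a endo \<Rightarrow> 'a endo \<Rightarrow> 'a endo" is "(o\<^sub>L)" .
lift_definition one_endo :: "'a endo" is id_blinfun .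

instance
proof
  have "norm (1::'a endo) = 1"
    by transfer simp
  then show "(0::'a endo) \<noteq> 1"
    by (metis norm_zero zero_neq_one)
qed (transfer; force intro!: blinfun_eqI norm_blinfun_compose simp: blinfun.bilinear_simps)+

end

lemma bounded_linear_blinfun_of_endo: "bounded_linear blinfun_of_endo"
  by (rule bounded_linear_intro[of _ 1]; transfer; simp)

lemma bounded_linear_Endo: "bounded_linear Endo"
  by (rule bounded_linear_intro[of _ 1])
     (simp_all add: plus_endo.abs_eq scaleR_endo.abs_eq norm_endo.abs_eq eq_onp_same_args)

text \<open>Completeness is carried over from the bounded linear maps along
  \<open>blinfun_of_endo\<close> and its inverse \<open>Endo\<close>, which are linear
  isometries.\<close>

instance endo :: ("{banach, perfect_space}") banach
proof
  fix X :: "nat \<Rightarrow> 'a endo"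
  assume "Cauchy X"
  then have "Cauchy (\<lambda>n. blinfun_of_endo (X n))"
    by (rule bounded_linear.Cauchy[OF bounded_linear_blinfun_of_endo])
  then obtain L where "(\<lambda>n. blinfun_of_endo (X n)) \<longlonglongrightarrow> L"
    using Cauchy_convergent_iff convergentD by blast
  then have "(\<lambda>n. Endo (blinfun_of_endo (X n))) \<longlonglongrightarrow> Endo L"
    by (rule bounded_linear.tendsto[OF bounded_linear_Endo])
  then show "convergent X"
    by (auto simp: blinfun_of_endo_inverse convergent_def)
qed

section \<open>Exponentials of superoperators\<close>

text \<open>A bounded linear map may be applied to a convergent series term by term. Through this
  identity the laws of \<open>exp\<close> become available for \<open>superop_exp\<close>.\<close>

lemma superop_exp_eq_exp: "superop_exp L = blinfun_of_endo (exp (Endo L))"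
proof -
  have pow: "((o\<^sub>L) L ^^ n) id_blinfun = blinfun_of_endo (Endo L ^ n)" for n
    by (induction n) (simp_all add: times_endo.rep_eq one_endo.rep_eq Endo_inverse)
  have "blinfun_of_endo (exp (Endo L)) = (\<Sum>n. blinfun_of_endo (Endo L ^ n /\<^sub>R fact n))"
    unfolding exp_def
    by (rule bounded_linear.suminf[OF bounded_linear_blinfun_of_endo summable_exp_generic])
  then show ?thesis
    by (simp add: superop_exp_def pow scaleR_endo.rep_eq divide_inverse)
qed

lemma superop_exp_zero [simp]: "superop_exp 0 = id_blinfun"
  by (simp add: superop_exp_eq_exp one_endo.rep_eq zero_endo_def[symmetric])

lemma Endo_scaleR: "Endo (c *\<^sub>R L) = c *\<^sub>R Endo L"
  by (simp add: scaleR_endo.abs_eq)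

lemma Endo_add: "Endo (L + M) = Endo L + Endo M"
  by (simp add: plus_endo.abs_eq)

lemma superop_exp_semigroup:
  "superop_exp (s *\<^sub>R L) o\<^sub>L superop_exp (t *\<^sub>R L) = superop_exp ((s + t) *\<^sub>R L)"
proof -
  have "exp (s *\<^sub>R Endo L + t *\<^sub>R Endo L) = exp (s *\<^sub>R Endo L) * exp (t *\<^sub>R Endo L)"
    by (rule exp_add_commuting) simp
  then show ?thesis
    by (simp add: superop_exp_eq_exp Endo_scaleR Endo_add times_endo.rep_eq[symmetric]
        scaleR_add_left)
qed

lemma continuous_on_superop_exp: "continuous_on S (\<lambda>t. superop_exp (t *\<^sub>R L))"
proof -
  have "continuous_on S (\<lambda>t. exp (t *\<^sub>R Endo L))"
    using exp_scaleR_has_vector_derivative_right has_vector_derivative_continuous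
    by (metis continuous_on_eq_continuous_within)
  then show ?thesis
    unfolding superop_exp_eq_exp Endo_scaleR
    by (rule bounded_linear.continuous_on[OF bounded_linear_blinfun_of_endo])
qed

lemma cscale_simps:
  fixes X Y :: "complex^'m^'m"
  shows "cscale c (X + Y) = cscale c X + cscale c Y"
    and "cscale c (r *\<^sub>R X) = r *\<^sub>R cscale c X"
    and "cscale c (0 :: complex^'m^'m) = 0"
    and "cscale (of_real r) X = r *\<^sub>R X"
  by (simp_all add: cscale_def map_matrix_def vec_eq_iff distrib_left
      scaleR_conv_of_real[where 'a = complex])

text \<open>The approximants are written as iterated compositions, so that closure under composition
  applies to them by induction.\<close>

lemma superop_Trotter:
  "(\<lambda>n. ((o\<^sub>L) (superop_exp ((1 / real n) *\<^sub>R L) o\<^sub>L superop_exp ((1 / real n) *\<^sub>R M)) ^^ n) id_blinfun)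
     \<longlonglongrightarrow> superop_exp (L + M)"
proof -
  have pow: "((o\<^sub>L) (blinfun_of_endo F) ^^ n) id_blinfun = blinfun_of_endo (F ^ n)"
    for F :: "(complex^'a^'a) endo" and n
    by (induction n) (simp_all add: times_endo.rep_eq one_endo.rep_eq)
  show ?thesis
    unfolding superop_exp_eq_exp Endo_scaleR Endo_add times_endo.rep_eq[symmetric] pow
    by (intro bounded_linear.tendsto[OF bounded_linear_blinfun_of_endo] Trotter_product_formula)
qed

section \<open>Continuity of the matrix operations and of the field\<close>

lemma tendsto_matrix_mult [tendsto_intros]:
  fixes A :: "'a \<Rightarrow> complex^'m^'n" and B :: "'a \<Rightarrow> complex^'p^'m"
  assumes "(A \<longlongrightarrow> a) F" "(B \<longlongrightarrow> b) F"
  shows "((\<lambda>x. A x ** B x) \<longlongrightarrow> a ** b) F"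
  unfolding matrix_matrix_mult_def
  by (intro vec_tendstoI) (auto intro!: tendsto_intros assms)

lemma tendsto_matrix_vector_mult [tendsto_intros]:
  fixes A :: "'a \<Rightarrow> complex^'m^'n" and v :: "'a \<Rightarrow> complex^'m"
  assumes "(A \<longlongrightarrow> a) F" "(v \<longlongrightarrow> b) F"
  shows "((\<lambda>x. A x *v v x) \<longlongrightarrow> a *v b) F"
  unfolding matrix_vector_mult_def
  by (intro vec_tendstoI) (auto intro!: tendsto_intros assms)

lemma tendsto_cip [tendsto_intros]:
  "(f \<longlongrightarrow> a) F \<Longrightarrow> (g \<longlongrightarrow> b) F \<Longrightarrow> ((\<lambda>x. cip (f x) (g x)) \<longlongrightarrow> cip a b) F"
  unfolding cip_def by (intro tendsto_intros)

lemma tendsto_cscale [tendsto_intros]: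
  "(f \<longlongrightarrow> a) F \<Longrightarrow> ((\<lambda>x. cscale c (f x)) \<longlongrightarrow> cscale c a) F"
  unfolding cscale_def map_matrix_def by (intro vec_tendstoI) (auto intro!: tendsto_intros)

lemma tendsto_adj [tendsto_intros]:
  "(f \<longlongrightarrow> a) F \<Longrightarrow> ((\<lambda>x. adj (f x)) \<longlongrightarrow> adj a) F"
  unfolding adj_def map_matrix_def transpose_def
  by (intro vec_tendstoI) (auto intro!: tendsto_intros)

lemma tendsto_ketbra [tendsto_intros]:
  "(f \<longlongrightarrow> a) F \<Longrightarrow> ((\<lambda>x. ketbra (f x)) \<longlongrightarrow> ketbra a) F"
  unfolding ketbra_def by (intro vec_tendstoI) (auto intro!: tendsto_intros)

lemma closed_psd: "closed {A :: complex^'m^'m. psd A}"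
proof -
  have "{A :: complex^'m^'m. psd A} = (\<Inter>v. (\<lambda>A. cip v (A *v v)) -` \<real>\<^sub>\<ge>\<^sub>0)"
    by (auto simp: psd_def)
  moreover have "closed ((\<lambda>A :: complex^'m^'m. cip v (A *v v)) -` \<real>\<^sub>\<ge>\<^sub>0)" for v
    by (intro closed_vimage) (auto simp: continuous_on_def intro!: tendsto_intros)
  ultimately show ?thesis
    by (simp add: closed_INT)
qed

text \<open>Conjugation fixes the reals, so the conjugate linear \<open>Z\<close> is real linear,
  hence bounded in finite dimension.\<close>

lemma tendsto_Z:
  assumes "CAR_field Z" "(f \<longlongrightarrow> a) F"
  shows "((\<lambda>x. Z (f x)) \<longlongrightarrow> Z a) F"
proof -
  have add: "Z (x + y) = Z x + Z y" and scale: "Z (c *s x) = cscale (cnj c) (Z x)" for x y c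
    using assms(1) unfolding CAR_field_def by blast+
  have "Z (r *\<^sub>R x) = r *\<^sub>R Z x" for r :: real and x
  proof -
    have "r *\<^sub>R x = complex_of_real r *s x"
      by (simp add: vec_eq_iff scaleR_conv_of_real[where 'a = complex])
    then show ?thesis
      by (simp add: scale cscale_simps)
  qed
  with add have "linear Z"
    by (rule linearI)
  then have "bounded_linear Z"
    by (rule linear_conv_bounded_linear[THEN iffD1])
  then show ?thesis
    using assms(2) by (rule bounded_linear.tendsto)
qed

section \<open>Compactness of the set of GIG states\<close>

text \<open>Eigenvalues and eigenvectors are merged into one sequence of pairs with the product
  topology. Its coordinates are continuous, and the product has a fixed finite list of factors, over
  which the induction runs.\<close>

lemma continuous_on_gauss_prod:
  assumes "CAR_field Z"
  shows "continuous_on UNIV (\<lambda>p. gauss_prod Z (\<lambda>j. fst (p j)) (\<lambda>j. snd (p j)))"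
proof -
  have coord: "((\<lambda>q. q j) \<longlongrightarrow> p j) (at p)" for p :: "nat \<Rightarrow> real \<times> (complex, 'a) vec" and j
    using continuous_on_product_coordinates[of j] by (auto simp: continuous_on_def)
  have foldr: "((\<lambda>q. foldr (**) (map (\<lambda>j. G j q) js) (mat 1)) \<longlongrightarrow>
      foldr (**) (map (\<lambda>j. G j p) js) (mat 1)) (at p)"
    if "\<And>j. (G j \<longlongrightarrow> G j p) (at p)"
    for G :: "nat \<Rightarrow> _ \<Rightarrow> complex^'b^'b" and js and p :: "nat \<Rightarrow> real \<times> (complex, 'a) vec"
    using that by (induction js) (auto intro!: tendsto_intros)
  show ?thesis
    unfolding continuous_on_def gauss_prod_def
    by (intro ballI foldr tendsto_intros tendsto_Z[OF assms] coord)
qed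

text \<open>By orthonormality only the term with index \<open>j\<close> of \<open>Q\<close> acts on
  \<open>\<psi> j\<close>. The eigenvalue thus becomes an expectation value, to which positivity of
  \<open>Q\<close> and of \<open>mat 1 - Q\<close> applies.\<close>

lemma onb_spectral_eigenvalue:
  fixes Q :: "complex^'n^'n"
  assumes "spectral_decomp Q \<mu> \<psi>" "j < CARD('n)"
  shows "cip (\<psi> j) (Q *v \<psi> j) = \<mu> j" "cip (\<psi> j) (\<psi> j) = 1"
proof -
  have onb: "cip (\<psi> i) (\<psi> k) = (if i = k then 1 else 0)" if "i < CARD('n)" "k < CARD('n)" for i k
    using assms(1) that by (auto simp: spectral_decomp_def is_onb_def)
  have ketbra_mult: "(r *\<^sub>R ketbra x) *v y = (of_real r * cip x y) *s x" for r and x y :: "complex^'n"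
    by (simp add: ketbra_def cip_def matrix_vector_mult_def vec_eq_iff sum_distrib_left mult_ac
        scaleR_conv_of_real[where 'a = complex])
  have "Q *v \<psi> j = (\<Sum>i<CARD('n). (\<mu> i *\<^sub>R ketbra (\<psi> i)) *v \<psi> j)"
    using assms(1)
    by (auto simp: spectral_decomp_def matrix_vector_mult_def vec_eq_iff sum_distrib_right
        intro: sum.swap)
  also have "\<dots> = (\<Sum>i<CARD('n). if i = j then \<mu> j *\<^sub>R \<psi> j else 0)"
    using assms(2)
    by (intro sum.cong) (auto simp: ketbra_mult onb vec_eq_iff scaleR_conv_of_real[where 'a = complex])
  also have "\<dots> = \<mu> j *\<^sub>R \<psi> j"
    using assms(2) by simp
  finally have "Q *v \<psi> j = \<mu> j *\<^sub>R \<psi> j" .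
  moreover have "cip (\<psi> j) (\<mu> j *\<^sub>R \<psi> j) = \<mu> j * cip (\<psi> j) (\<psi> j)"
    by (simp add: cip_def sum_distrib_left scaleR_conv_of_real[where 'a = complex] mult_ac)
  ultimately show "cip (\<psi> j) (Q *v \<psi> j) = \<mu> j" "cip (\<psi> j) (\<psi> j) = 1"
    using onb[OF assms(2) assms(2)] by auto
qed

text \<open>These bounds confine the relevant entries of a spectral decomposition to a compact
  set.\<close>

lemma symbol_eigenvalue_bounds:
  fixes Q :: "complex^'n^'n"
  assumes "spectral_decomp Q \<mu> \<psi>" "psd Q" "psd (mat 1 - Q)" "j < CARD('n)"
  shows "0 \<le> \<mu> j" "\<mu> j \<le> 1" "norm (\<psi> j) \<le> 1"
proof -
  note ev = onb_spectral_eigenvalue[OF assms(1,4)]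
  show "0 \<le> \<mu> j"
    using assms(2) ev by (metis psd_def nonneg_Reals_of_real_iff)
  have "cip (\<psi> j) ((mat 1 - Q) *v \<psi> j) = cip (\<psi> j) (\<psi> j) - cip (\<psi> j) (Q *v \<psi> j)"
    by (simp add: matrix_vector_mult_diff_rdistrib cip_def right_diff_distrib sum_subtractf)
  also have "\<dots> = complex_of_real (1 - \<mu> j)"
    using ev by simp
  finally show "\<mu> j \<le> 1"
    using assms(3) by (metis psd_def nonneg_Reals_of_real_iff diff_ge_0_iff_ge)
  have "complex_of_real ((norm (\<psi> j))\<^sup>2) = cip (\<psi> j) (\<psi> j)"
    by (simp add: norm_vec_def L2_set_def sum_nonneg cip_def complex_norm_square mult.commute
        del: of_real_power)
  then show "norm (\<psi> j) \<le> 1"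
    using ev norm_ge_zero[of "\<psi> j"] by (auto simp: power2_eq_1_iff simp flip: of_real_power)
qed

text \<open>\<open>K\<close> is a product of compact sets. The conditions on orthonormality and on
  the symbol cut out a closed part \<open>D\<close> of it, which \<open>R\<close> maps continuously
  onto the GIG states.\<close>

theorem compact_gig_states:
  fixes Z :: "complex^'n \<Rightarrow> complex^'k^'k"
  assumes "CAR_field Z"
  shows "compact (gig_states Z)"
proof -
  define Q where "Q p = (\<Sum>j<CARD('n). fst (p j) *\<^sub>R ketbra (snd (p j)))"
    for p :: "nat \<Rightarrow> real \<times> (complex^'n)"
  define R where "R p = gauss_prod Z (\<lambda>j. fst (p j)) (\<lambda>j. snd (p j))"
    for p :: "nat \<Rightarrow> real \<times> (complex^'n)"
  define K where "K = PiE UNIV (\<lambda>j::nat. {0..1::real} \<times> cball (0 :: complex^'n) 1)"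
  define C where "C = {p :: nat \<Rightarrow> real \<times> (complex^'n). is_onb (\<lambda>j. snd (p j))}"
  define D where "D = K \<inter> (C \<inter> (Q -` {A. psd A} \<inter> (\<lambda>p. mat 1 - Q p) -` {A. psd A}))"
  \<comment> \<open>Tychonoff's theorem for the infinite product.\<close>
  have "compactin (product_topology (\<lambda>i. euclidean) UNIV) K"
    unfolding K_def compactin_PiE by (auto intro!: compact_Times)
  then have "compact K"
    by (simp add: euclidean_product_topology)
  have coord: "((\<lambda>q. q j) \<longlongrightarrow> p j) (at p)" for p :: "nat \<Rightarrow> real \<times> (complex^'n)" and j
    using continuous_on_product_coordinates[of j] by (auto simp: continuous_on_def)
  have "continuous_on UNIV Q"
    unfolding continuous_on_def Q_def by (intro ballI tendsto_intros coord)
  then have "closed (Q -` {A. psd A})" "closed ((\<lambda>p. mat 1 - Q p) -` {A. psd A})"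
    by (intro closed_vimage closed_psd continuous_intros; simp)+
  moreover have "closed C"
  proof -
    have "C = (\<Inter>i<CARD('n). \<Inter>j<CARD('n).
        (\<lambda>p. cip (snd (p i)) (snd (p j))) -` {if i = j then 1 else 0})"
      by (auto simp: C_def is_onb_def)
    moreover have "closed ((\<lambda>p :: nat \<Rightarrow> real \<times> (complex^'n). cip (snd (p i)) (snd (p j))) -` {c})"
      for i j c
      by (intro closed_vimage) (auto simp: continuous_on_def intro!: tendsto_intros coord)
    ultimately show ?thesis
      by (simp add: closed_INT)
  qed
  ultimately have "compact D"
    unfolding D_def by (intro compact_Int_closed \<open>compact K\<close> closed_Int)
  then have "compact (R ` D)"
    unfolding R_def
    by (intro compact_continuous_image continuous_on_subset[OF continuous_on_gauss_prod[OF assms]])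
       auto
  also have "R ` D = gig_states Z"
  proof (intro equalityI subsetI)
    fix \<rho> assume "\<rho> \<in> R ` D"
    then obtain p where "is_onb (\<lambda>j. snd (p j))" "psd (Q p)" "psd (mat 1 - Q p)" "\<rho> = R p"
      by (auto simp: C_def D_def)
    then show "\<rho> \<in> gig_states Z"
      by (fastforce simp: gig_states_def gig_density_def spectral_decomp_def Q_def R_def)
  next
    fix \<rho> assume "\<rho> \<in> gig_states Z"
    then obtain A \<mu> \<psi> where A: "psd A" "psd (mat 1 - A)" "spectral_decomp A \<mu> \<psi>"
      and \<rho>: "\<rho> = gauss_prod Z \<mu> \<psi>"
      by (auto simp: gig_states_def gig_density_def)
    \<comment> \<open>The entries from \<open>CARD('n)\<close> on are arbitrary in a spectral
      decomposition and may lie outside the compact factors. Resetting them to 0 puts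
      \<open>p\<close> into \<open>K\<close> and changes neither symbol nor density.\<close>
    define p where "p j = (if j < CARD('n) then (\<mu> j, \<psi> j) else (0, 0))" for j
    have "p \<in> K"
      using symbol_eigenvalue_bounds[OF A(3,1,2)] by (auto simp: K_def p_def)
    moreover have "is_onb (\<lambda>j. snd (p j))" "Q p = A"
      using A(3) by (auto simp: spectral_decomp_def is_onb_def p_def Q_def)
    moreover have "R p = \<rho>"
      unfolding R_def \<rho> gauss_prod_def p_def
      by (rule arg_cong[of _ _ "\<lambda>xs. foldr (**) xs (mat 1)"]) simp
    ultimately show "\<rho> \<in> R ` D"
      using A(1,2) by (auto simp: C_def D_def intro!: image_eqI[of _ _ p])
  qed
  finally show ?thesis .
qed

section \<open>GIG operations under composition and limits\<close>

lemma quantum_operation_compose: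
  "quantum_operation \<Phi> \<Longrightarrow> quantum_operation \<Psi> \<Longrightarrow> quantum_operation (\<Phi> o\<^sub>L \<Psi>)"
  by (simp add: quantum_operation_def complex_linear_def completely_positive_def trace_preserving_def)

lemma gig_operation_compose:
  "gig_operation Z \<Phi> \<Longrightarrow> gig_operation Z \<Psi> \<Longrightarrow> gig_operation Z (\<Phi> o\<^sub>L \<Psi>)"
  by (simp add: gig_operation_def quantum_operation_compose gauge_covariant_def)

lemma gig_operation_id: "gig_operation Z id_blinfun"
  by (simp add: gig_operation_def gauge_covariant_def quantum_operation_def complex_linear_def
      completely_positive_def trace_preserving_def)

text \<open>For fixed arguments each condition is an equation between continuous functions of the
  operation or membership in the closed set of nonnegative reals, so it survives the limit.\<close>

lemma quantum_operation_limit: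
  assumes lim: "P \<longlonglongrightarrow> \<Phi>" and P: "\<And>n :: nat. quantum_operation (P n)"
  shows "quantum_operation \<Phi>"
proof -
  have app: "(\<lambda>n. P n X) \<longlonglongrightarrow> \<Phi> X" for X
    by (intro tendsto_intros lim)
  have "\<Phi> (cscale c X) = cscale c (\<Phi> X)" for c X
    using LIMSEQ_unique[OF app[of "cscale c X"]] tendsto_cscale[OF app[of X], of c] P
    by (simp add: quantum_operation_def complex_linear_def)
  moreover have "block_psd n (\<lambda>i j. \<Phi> (X i j))" if "block_psd n X" for n X
    unfolding block_psd_def
  proof
    fix v :: "nat \<Rightarrow> (complex, 'a) vec"
    have "(\<lambda>m. \<Sum>i<n. \<Sum>j<n. cip (v i) (P m (X i j) *v v j)) \<longlonglongrightarrow>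
        (\<Sum>i<n. \<Sum>j<n. cip (v i) (\<Phi> (X i j) *v v j))"
      by (intro tendsto_intros app)
    moreover have "(\<Sum>i<n. \<Sum>j<n. cip (v i) (P m (X i j) *v v j)) \<in> \<real>\<^sub>\<ge>\<^sub>0" for m
      using P[of m] that by (auto simp: quantum_operation_def completely_positive_def block_psd_def)
    ultimately show "(\<Sum>i<n. \<Sum>j<n. cip (v i) (\<Phi> (X i j) *v v j)) \<in> \<real>\<^sub>\<ge>\<^sub>0"
      by (rule closed_sequentially[OF closed_nonneg_Reals_complex, rotated])
  qed
  moreover have "trace (\<Phi> X) = trace X" for X
  proof -
    have "(\<lambda>n. trace (P n X)) \<longlonglongrightarrow> trace (\<Phi> X)"
      unfolding trace_def by (intro tendsto_intros app)
    then show ?thesis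
      using P by (simp add: quantum_operation_def trace_preserving_def LIMSEQ_const_iff)
  qed
  ultimately show ?thesis
    by (simp add: quantum_operation_def complex_linear_def completely_positive_def
        trace_preserving_def)
qed

text \<open>Compactness makes the set of GIG states closed, so the limits of images of a GIG state
  stay in it.\<close>

lemma gig_operation_limit:
  assumes "CAR_field Z" and lim: "P \<longlonglongrightarrow> \<Phi>" and P: "\<And>n :: nat. gig_operation Z (P n)"
  shows "gig_operation Z \<Phi>"
proof -
  have app: "(\<lambda>n. P n X) \<longlonglongrightarrow> \<Phi> X" for X
    by (intro tendsto_intros lim)
  have "\<Phi> \<rho> \<in> gig_states Z" if "\<rho> \<in> gig_states Z" for \<rho>
    using P that
    by (intro closed_sequentially[OF compact_imp_closed[OF compact_gig_states[OF assms(1)]] _ app])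
       (auto simp: gig_operation_def)
  \<comment> \<open>Gauge covariance is the case where \<open>U\<close> and \<open>V\<close> are the
    exponentials of the number operator; only continuity of matrix multiplication matters.\<close>
  moreover have "\<Phi> (U ** X ** V) = U ** \<Phi> X ** V" if "\<And>n. P n (U ** X ** V) = U ** P n X ** V" for U X V
  proof (rule LIMSEQ_unique[OF app])
    show "(\<lambda>n. P n (U ** X ** V)) \<longlonglongrightarrow> U ** \<Phi> X ** V"
      unfolding that by (intro tendsto_intros app)
  qed
  ultimately show ?thesis
    using P quantum_operation_limit[OF lim] by (simp add: gig_operation_def gauge_covariant_def)
qed

section \<open>The cone of generators\<close>

text \<open>The semigroup law, the value at time 0 and continuity hold for every exponential
  family.\<close>

lemma gig_generators_iff:
  "L \<in> gig_generators Z \<longleftrightarrow>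
     complex_linear L \<and> (\<forall>t\<ge>0. gig_operation Z (superop_exp (t *\<^sub>R L)))"
  by (auto simp: gig_generators_def gig_semigroup_def superop_exp_semigroup
      continuous_on_superop_exp)

text \<open>Scaling a generator by \<open>c\<close> runs its semigroup at time \<open>t * c\<close>,
  which is again nonnegative.\<close>

lemma gig_generators_scaleR:
  assumes "L \<in> gig_generators Z" "0 \<le> c"
  shows "c *\<^sub>R L \<in> gig_generators Z"
  using assms
  by (simp add: gig_generators_iff complex_linear_def blinfun.bilinear_simps cscale_simps)

lemma gig_generators_add:
  assumes "CAR_field Z" "L \<in> gig_generators Z" "M \<in> gig_generators Z"
  shows "L + M \<in> gig_generators Z"
proof -
  have "gig_operation Z (superop_exp (t *\<^sub>R (L + M)))" if "0 \<le> t" for t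
  proof (rule gig_operation_limit[OF assms(1)])
    show "(\<lambda>n. ((o\<^sub>L) (superop_exp ((1 / real n) *\<^sub>R (t *\<^sub>R L)) o\<^sub>L
        superop_exp ((1 / real n) *\<^sub>R (t *\<^sub>R M))) ^^ n) id_blinfun) \<longlonglongrightarrow> superop_exp (t *\<^sub>R (L + M))"
      unfolding scaleR_add_right by (rule superop_Trotter)
  next
    fix n :: nat
    have "gig_operation Z (superop_exp ((1 / real n) *\<^sub>R (t *\<^sub>R L)) o\<^sub>L
        superop_exp ((1 / real n) *\<^sub>R (t *\<^sub>R M)))"
      using assms that by (intro gig_operation_compose) (simp_all add: gig_generators_iff)
    \<comment> \<open>The number \<open>m\<close> of iterations is separated from the
      \<open>n\<close> in the step size, which stays fixed during the induction.\<close>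
    then have "gig_operation Z (((o\<^sub>L) (superop_exp ((1 / real n) *\<^sub>R (t *\<^sub>R L)) o\<^sub>L
        superop_exp ((1 / real n) *\<^sub>R (t *\<^sub>R M))) ^^ m) id_blinfun)" for m
      by (induction m) (simp_all add: gig_operation_id gig_operation_compose)
    then show "gig_operation Z (((o\<^sub>L) (superop_exp ((1 / real n) *\<^sub>R (t *\<^sub>R L)) o\<^sub>L
        superop_exp ((1 / real n) *\<^sub>R (t *\<^sub>R M))) ^^ n) id_blinfun)" .
  qed
  then show ?thesis
    using assms
    by (simp add: gig_generators_iff complex_linear_def blinfun.bilinear_simps cscale_simps)
qed

lemma zero_gig_generator: "0 \<in> gig_generators Z"
  by (simp add: gig_generators_iff complex_linear_def gig_operation_id cscale_simps)

theorem theorem5p18: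
  fixes Z :: "complex^'n \<Rightarrow> complex^'k^'k"
  assumes "CAR_field Z" and "irreducible_field Z"
  shows "convex_cone (gig_generators Z) \<and>
         (\<forall>L1\<in>gig_generators Z. \<forall>L2\<in>gig_generators Z. \<forall>a\<ge>0. \<forall>b\<ge>0.
            a *\<^sub>R L1 + b *\<^sub>R L2 \<in> gig_generators Z)"
  \<comment> \<open>A convex cone is characterised by containing 0 and being closed under sums and
    nonnegative multiples.\<close>
  by (simp add: convex_cone_iff zero_gig_generator gig_generators_scaleR
      gig_generators_add[OF assms(1)])

end
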